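(* For all data $\alpha,\beta$: if $\alpha\vDash\beta$ then there exists a datum $\gamma$ such that $L(\gamma)\subseteq L(\alpha)\cap L(\beta)$, $\gamma$ is analytically deducible from $\alpha$ in DC, and $\beta$ is quasi-synthetically deducible from $\gamma$ in DC.
   Context: Formulas are those of classical propositional logic, built from propositional variables with $\neg,\wedge,\vee$. A datum is a finite set of finite sets of formulas; its elements are called components. $L(\alpha)$ is the set of propositional variables occurring in $\alpha$. Notation: $\Gamma,A$ is $\Gamma\cup\{A\}$; $\Gamma,\Delta$ is $\Gamma\cup\Delta$; $\Gamma/\rho$ is $\{\Gamma\}\cup\rho$ and $\Gamma/\Delta/\rho$ is $\{\Gamma,\Delta\}\cup\rho$, where $\rho$ is any datum (possibly empty, overlaps allowed). An interpretation (assignment of truth-values to the variables) verifies a datum if it verifies every formula of at least one component. $\alpha\vDash\beta$ means that every interpretation verifying $\alpha$ verifies $\beta$. Rules of the Data Calculus (DC). G-rules (each line is a pair of rules: the analytic rule infers the right side from the left side, the synthetic rule infers the left side from the right side): $\Gamma,A\wedge B/\rho$ and $\Gamma,A,B/\rho$; $\Gamma,A\vee B/\rho$ and $\Gamma,A/\Gamma,B/\rho$; $\Gamma,\neg\neg A/\rho$ and $\Gamma,A/\rho$; $\Gamma,\neg(A\vee B)/\rho$ and $\Gamma,\neg A,\neg B/\rho$; $\Gamma,\neg(A\wedge B)/\rho$ and $\Gamma,\neg A/\Gamma,\neg B/\rho$. N-rules: NC (analytic): from $\Gamma,A,\neg A/\rho$ infer $\rho$. EM (synthetic): from $\Gamma/\rho$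 infer $\Gamma,A/\Gamma,\neg A/\rho$. S-rules: Del (analytic): from $\Gamma,\Delta/\rho$ infer $\Gamma/\rho$. Exp (synthetic): from $\rho$ infer $\Gamma/\rho$. A deduction of $\beta$ from $\alpha$ is a finite sequence of data starting with $\alpha$ and ending with $\beta$ in which each datum after the first is inferable from the immediately preceding one by one of the rules. It is analytic if all steps use analytic rules; it is quasi-synthetic if every step uses either a synthetic rule or an S-rule (so Del is also allowed). "Analytically (quasi-synthetically) deducible" means that an analytic (quasi-synthetic) deduction exists. *)

theory Defs
  imports Main "HOL-Library.FSet"
begin

datatype (atoms: 'a) form =
    Var 'a
  | Neg "'a form"
  | And "'a form" "'a form"
  | Or "'a form" "'a form"

type_synonym 'a datum = "'a form fset fset"

definition atoms_datum :: "'a datum \<Rightarrow> 'a set" where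
  "atoms_datum \<alpha> = (\<Union>\<Gamma>\<in>fset \<alpha>. \<Union>A\<in>fset \<Gamma>. atoms A)"

primrec holds :: "('a \<Rightarrow> bool) \<Rightarrow> 'a form \<Rightarrow> bool" where
  "holds v (Var p) \<longleftrightarrow> v p"
| "holds v (Neg A) \<longleftrightarrow> \<not> holds v A"
| "holds v (And A B) \<longleftrightarrow> holds v A \<and> holds v B"
| "holds v (Or A B) \<longleftrightarrow> holds v A \<or> holds v B"

definition verifies :: "('a \<Rightarrow> bool) \<Rightarrow> 'a datum \<Rightarrow> bool" where
  "verifies v \<alpha> \<longleftrightarrow> (\<exists>\<Gamma>. \<Gamma> |\<in>| \<alpha> \<and> (\<forall>A. A |\<in>| \<Gamma> \<longrightarrow> holds v A))"

definition entails :: "'a datum \<Rightarrow> 'a datum \<Rightarrow> bool" where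
  "entails \<alpha> \<beta> \<longleftrightarrow> (\<forall>v. verifies v \<alpha> \<longrightarrow> verifies v \<beta>)"

text \<open>
  In all rules the displayed union or insertion need not be disjoint, so the principal formula
  may also lie in \<open>\<Gamma>\<close> and the principal component may also lie in \<open>\<rho>\<close>.

  \<open>G_rule\<close> relates the left to the right side of each G-rule pair; the analytic G-rules are this
  relation and the synthetic ones its converse.
\<close>

inductive G_rule :: "'a datum \<Rightarrow> 'a datum \<Rightarrow> bool" where
  G_And: "G_rule (finsert (finsert (And A B) \<Gamma>) \<rho>)
                 (finsert (finsert A (finsert B \<Gamma>)) \<rho>)"
| G_Or: "G_rule (finsert (finsert (Or A B) \<Gamma>) \<rho>)
                (finsert (finsert A \<Gamma>) (finsert (finsert B \<Gamma>) \<rho>))"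
| G_NegNeg: "G_rule (finsert (finsert (Neg (Neg A)) \<Gamma>) \<rho>)
                    (finsert (finsert A \<Gamma>) \<rho>)"
| G_NegOr: "G_rule (finsert (finsert (Neg (Or A B)) \<Gamma>) \<rho>)
                   (finsert (finsert (Neg A) (finsert (Neg B) \<Gamma>)) \<rho>)"
| G_NegAnd: "G_rule (finsert (finsert (Neg (And A B)) \<Gamma>) \<rho>)
                    (finsert (finsert (Neg A) \<Gamma>) (finsert (finsert (Neg B) \<Gamma>) \<rho>))"

inductive NC_rule :: "'a datum \<Rightarrow> 'a datum \<Rightarrow> bool" where
  NC: "NC_rule (finsert (finsert A (finsert (Neg A) \<Gamma>)) \<rho>) \<rho>"

inductive EM_rule :: "'a datum \<Rightarrow> 'a datum \<Rightarrow> bool" where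
  EM: "EM_rule (finsert \<Gamma> \<rho>) (finsert (finsert A \<Gamma>) (finsert (finsert (Neg A) \<Gamma>) \<rho>))"

inductive Del_rule :: "'a datum \<Rightarrow> 'a datum \<Rightarrow> bool" where
  Del: "Del_rule (finsert (\<Gamma> |\<union>| \<Delta>) \<rho>) (finsert \<Gamma> \<rho>)"

inductive Exp_rule :: "'a datum \<Rightarrow> 'a datum \<Rightarrow> bool" where
  Exp: "Exp_rule \<rho> (finsert \<Gamma> \<rho>)"

definition analytic_step :: "'a datum \<Rightarrow> 'a datum \<Rightarrow> bool" where
  "analytic_step \<alpha> \<beta> \<longleftrightarrow> G_rule \<alpha> \<beta> \<or> NC_rule \<alpha> \<beta> \<or> Del_rule \<alpha> \<beta>"

definition synthetic_step :: "'a datum \<Rightarrow> 'a datum \<Rightarrow> bool" where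
  "synthetic_step \<alpha> \<beta> \<longleftrightarrow> G_rule \<beta> \<alpha> \<or> EM_rule \<alpha> \<beta> \<or> Exp_rule \<alpha> \<beta>"

definition S_step :: "'a datum \<Rightarrow> 'a datum \<Rightarrow> bool" where
  "S_step \<alpha> \<beta> \<longleftrightarrow> Del_rule \<alpha> \<beta> \<or> Exp_rule \<alpha> \<beta>"

definition quasi_synthetic_step :: "'a datum \<Rightarrow> 'a datum \<Rightarrow> bool" where
  "quasi_synthetic_step \<alpha> \<beta> \<longleftrightarrow> synthetic_step \<alpha> \<beta> \<or> S_step \<alpha> \<beta>"

definition deduction ::
  "('a datum \<Rightarrow> 'a datum \<Rightarrow> bool) \<Rightarrow> 'a datum \<Rightarrow> 'a datum \<Rightarrow> 'a datum list \<Rightarrow> bool" where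
  "deduction step \<alpha> \<beta> ds \<longleftrightarrow>
     ds \<noteq> [] \<and> hd ds = \<alpha> \<and> last ds = \<beta> \<and> successively step ds"

definition analytically_deducible :: "'a datum \<Rightarrow> 'a datum \<Rightarrow> bool" where
  "analytically_deducible \<alpha> \<beta> \<longleftrightarrow> (\<exists>ds. deduction analytic_step \<alpha> \<beta> ds)"

definition quasi_synthetically_deducible :: "'a datum \<Rightarrow> 'a datum \<Rightarrow> bool" where
  "quasi_synthetically_deducible \<alpha> \<beta> \<longleftrightarrow> (\<exists>ds. deduction quasi_synthetic_step \<alpha> \<beta> ds)"

end

(* Decompose every formula of \<alpha> and of \<beta> into literals by the G-rules, which preserves
   truth values and atoms, giving \<alpha>' and \<beta>'. The interpolant \<gamma> arises from \<alpha>' by dropping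
   the contradictory components (NC) and deleting the literals foreign to \<beta> (Del). It still
   entails \<beta>', since a valuation of a restricted component can be changed outside the atoms of
   \<beta> so as to verify the whole consistent component. Splitting the components of \<gamma> by EM on all
   atoms of \<beta>' makes each of them include a component of \<beta>', so Del and Exp lead to \<beta>', and
   the synthetic G-rules lead from there to \<beta>. *)

theory Submission
  imports Defs
begin

section \<open>Deduction sequences as reflexive transitive closures\<close>

lemma ex_deduction_iff_rtranclp: "(\<exists>ds. deduction R \<alpha> \<beta> ds) \<longleftrightarrow> R\<^sup>*\<^sup>* \<alpha> \<beta>"
proof
  assume "\<exists>ds. deduction R \<alpha> \<beta> ds"
  then obtain ds where "deduction R \<alpha> \<beta> ds" ..
  then show "R\<^sup>*\<^sup>* \<alpha> \<beta>"
  proof (induction ds arbitrary: \<alpha>)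
    case Nil
    then show ?case by (simp add: deduction_def)
  next
    case (Cons d ds)
    show ?case
    proof (cases ds)
      case Nil
      with Cons.prems show ?thesis by (auto simp: deduction_def)
    next
      case (Cons e es)
      with Cons.prems have "R \<alpha> e" "deduction R e \<beta> ds"
        by (auto simp: deduction_def)
      with Cons.IH show ?thesis by (meson converse_rtranclp_into_rtranclp)
    qed
  qed
next
  assume "R\<^sup>*\<^sup>* \<alpha> \<beta>"
  then show "\<exists>ds. deduction R \<alpha> \<beta> ds"
  proof (induction rule: converse_rtranclp_induct)
    case base
    have "deduction R \<beta> \<beta> [\<beta>]" by (simp add: deduction_def)
    then show ?case ..
  next
    case (step \<alpha> \<delta>)
    then obtain ds where "deduction R \<delta> \<beta> ds" by blast
    with step.hyps(1) have "deduction R \<alpha> \<beta> (\<alpha> # ds)"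
      by (cases ds) (auto simp: deduction_def)
    then show ?case ..
  qed
qed

section \<open>Rules in the presence of side components\<close>

lemma G_rule_funion: "G_rule \<alpha> \<beta> \<Longrightarrow> G_rule (\<alpha> |\<union>| \<sigma>) (\<beta> |\<union>| \<sigma>)"
  by (induction rule: G_rule.induct) (auto intro: G_rule.intros)

lemma NC_rule_funion: "NC_rule \<alpha> \<beta> \<Longrightarrow> NC_rule (\<alpha> |\<union>| \<sigma>) (\<beta> |\<union>| \<sigma>)"
  by (induction rule: NC_rule.induct) (auto intro: NC_rule.intros)

lemma EM_rule_funion: "EM_rule \<alpha> \<beta> \<Longrightarrow> EM_rule (\<alpha> |\<union>| \<sigma>) (\<beta> |\<union>| \<sigma>)"
  by (induction rule: EM_rule.induct) (auto intro: EM_rule.intros)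

lemma Del_rule_funion: "Del_rule \<alpha> \<beta> \<Longrightarrow> Del_rule (\<alpha> |\<union>| \<sigma>) (\<beta> |\<union>| \<sigma>)"
  by (induction rule: Del_rule.induct) (auto intro: Del_rule.intros)

lemma Exp_rule_funion: "Exp_rule \<alpha> \<beta> \<Longrightarrow> Exp_rule (\<alpha> |\<union>| \<sigma>) (\<beta> |\<union>| \<sigma>)"
  by (induction rule: Exp_rule.induct) (auto intro: Exp_rule.intros)

lemma analytic_step_funion:
  "analytic_step \<alpha> \<beta> \<Longrightarrow> analytic_step (\<alpha> |\<union>| \<sigma>) (\<beta> |\<union>| \<sigma>)"
  unfolding analytic_step_def by (blast intro: G_rule_funion NC_rule_funion Del_rule_funion)

lemma quasi_synthetic_step_funion:
  "quasi_synthetic_step \<alpha> \<beta> \<Longrightarrow> quasi_synthetic_step (\<alpha> |\<union>| \<sigma>) (\<beta> |\<union>| \<sigma>)"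
  unfolding quasi_synthetic_step_def synthetic_step_def S_step_def
  by (blast intro: G_rule_funion EM_rule_funion Del_rule_funion Exp_rule_funion)

lemma rtranclp_funion:
  assumes "\<And>\<alpha> \<beta> \<sigma>. R \<alpha> \<beta> \<Longrightarrow> R (\<alpha> |\<union>| \<sigma>) (\<beta> |\<union>| \<sigma>)" and "R\<^sup>*\<^sup>* \<alpha> \<beta>"
  shows "R\<^sup>*\<^sup>* (\<alpha> |\<union>| \<sigma>) (\<beta> |\<union>| \<sigma>)"
  using assms(2)
  by (induction rule: rtranclp_induct) (auto intro: rtranclp.rtrancl_into_rtrancl assms(1))

text \<open>Components can be rewritten one at a time: while one is treated, the finished and the
  waiting ones are carried along as side components. This reduces each transformation of a datum to
  its effect on a singleton.\<close>

lemma rtranclp_componentwise: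
  assumes R: "\<And>\<alpha> \<beta> \<sigma>. R \<alpha> \<beta> \<Longrightarrow> R (\<alpha> |\<union>| \<sigma>) (\<beta> |\<union>| \<sigma>)"
    and "\<And>\<Gamma>. \<Gamma> |\<in>| \<alpha> \<Longrightarrow> \<exists>\<delta>. R\<^sup>*\<^sup>* {|\<Gamma>|} \<delta> \<and> (\<forall>\<Delta>. \<Delta> |\<in>| \<delta> \<longrightarrow> Q \<Delta>)"
  shows "\<exists>\<delta>. R\<^sup>*\<^sup>* \<alpha> \<delta> \<and> (\<forall>\<Delta>. \<Delta> |\<in>| \<delta> \<longrightarrow> Q \<Delta>)"
  using assms(2)
proof (induction \<alpha>)
  case empty
  then show ?case by (intro exI[of _ "{||}"]) simp
next
  case (insert \<Gamma> \<rho>)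
  obtain \<delta>\<^sub>1 where 1: "R\<^sup>*\<^sup>* {|\<Gamma>|} \<delta>\<^sub>1" "\<forall>\<Delta>. \<Delta> |\<in>| \<delta>\<^sub>1 \<longrightarrow> Q \<Delta>"
    using insert.prems[of \<Gamma>] by auto
  obtain \<delta>\<^sub>2 where 2: "R\<^sup>*\<^sup>* \<rho> \<delta>\<^sub>2" "\<forall>\<Delta>. \<Delta> |\<in>| \<delta>\<^sub>2 \<longrightarrow> Q \<Delta>"
    using insert.IH insert.prems by auto
  have "R\<^sup>*\<^sup>* (finsert \<Gamma> \<rho>) (\<delta>\<^sub>1 |\<union>| \<rho>)"
    using rtranclp_funion[OF R 1(1), of \<rho>] by simp
  also have "R\<^sup>*\<^sup>* (\<delta>\<^sub>1 |\<union>| \<rho>) (\<delta>\<^sub>1 |\<union>| \<delta>\<^sub>2)"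
    using rtranclp_funion[OF R 2(1), of \<delta>\<^sub>1] by (simp add: funion_commute)
  finally show ?case
    using 1(2) 2(2) by (intro exI[of _ "\<delta>\<^sub>1 |\<union>| \<delta>\<^sub>2"]) auto
qed

section \<open>Truth values and atoms under the G-rules\<close>

lemma verifies_finsert:
  "verifies v (finsert \<Gamma> \<rho>) \<longleftrightarrow> (\<forall>A. A |\<in>| \<Gamma> \<longrightarrow> holds v A) \<or> verifies v \<rho>"
  unfolding verifies_def by auto

lemma G_rule_verifies: "G_rule \<alpha> \<beta> \<Longrightarrow> verifies v \<alpha> \<longleftrightarrow> verifies v \<beta>"
  by (induction rule: G_rule.induct) (simp_all add: verifies_finsert, auto)

lemma G_rule_atoms_datum: "G_rule \<alpha> \<beta> \<Longrightarrow> atoms_datum \<alpha> = atoms_datum \<beta>"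
  by (induction rule: G_rule.induct) (auto simp: atoms_datum_def)

lemma G_rules_verifies: "G_rule\<^sup>*\<^sup>* \<alpha> \<beta> \<Longrightarrow> verifies v \<alpha> \<longleftrightarrow> verifies v \<beta>"
  by (induction rule: rtranclp_induct) (auto simp: G_rule_verifies)

lemma G_rules_atoms_datum: "G_rule\<^sup>*\<^sup>* \<alpha> \<beta> \<Longrightarrow> atoms_datum \<alpha> = atoms_datum \<beta>"
  by (induction rule: rtranclp_induct) (auto simp: G_rule_atoms_datum)

lemma holds_cong: "(\<And>p. p \<in> atoms A \<Longrightarrow> v p = w p) \<Longrightarrow> holds v A = holds w A"
  by (induction A) auto

lemma verifies_cong:
  assumes "\<And>p. p \<in> atoms_datum \<alpha> \<Longrightarrow> v p = w p"
  shows "verifies v \<alpha> \<longleftrightarrow> verifies w \<alpha>"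
proof -
  have "holds v A = holds w A" if "\<Gamma> |\<in>| \<alpha>" "A |\<in>| \<Gamma>" for \<Gamma> A
    by (rule holds_cong, rule assms) (use that in \<open>auto simp: atoms_datum_def\<close>)
  then show ?thesis unfolding verifies_def by blast
qed

section \<open>Decomposition into literals\<close>

definition literal :: "'a form \<Rightarrow> bool" where
  "literal A \<longleftrightarrow> (\<exists>p. A = Var p \<or> A = Neg (Var p))"

text \<open>Only clashes between a variable and its negation are tested; for a set of literals this
  amounts to satisfiability.\<close>

definition consistent :: "'a form fset \<Rightarrow> bool" where
  "consistent \<Gamma> \<longleftrightarrow> (\<forall>p. \<not> (Var p |\<in>| \<Gamma> \<and> Neg (Var p) |\<in>| \<Gamma>))"

text \<open>Binary connectives count twice, so that replacing \<open>Neg (Or A B)\<close> by the two formulas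
  \<open>Neg A\<close> and \<open>Neg B\<close> lowers the total.\<close>

primrec weight :: "'a form \<Rightarrow> nat" where
  "weight (Var p) = 0"
| "weight (Neg A) = Suc (weight A)"
| "weight (And A B) = weight A + weight B + 2"
| "weight (Or A B) = weight A + weight B + 2"

text \<open>Only an inequality is available, because a formula already in \<Gamma> is not counted a
  second time.\<close>

lemma sum_weight_finsert_le:
  "sum weight (fset (finsert A \<Gamma>)) \<le> weight A + sum weight (fset \<Gamma>)"
  by (cases "A |\<in>| \<Gamma>") (auto simp: insert_absorb)

text \<open>Each G-rule replaces its principal formula by formulas of smaller total weight in each
  resulting component. Since \<open>C\<close> is not in \<Gamma>, it really disappears; a copy left
  in \<Gamma> could prevent the decrease.\<close>

lemma ex_G_rule_decrease:
  assumes "\<not> literal C" "C |\<notin>| \<Gamma>"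
  shows "\<exists>\<delta>. G_rule {|finsert C \<Gamma>|} \<delta> \<and>
    (\<forall>\<Delta>. \<Delta> |\<in>| \<delta> \<longrightarrow> sum weight (fset \<Delta>) < sum weight (fset (finsert C \<Gamma>)))"
proof -
  have C: "sum weight (fset (finsert C \<Gamma>)) = weight C + sum weight (fset \<Gamma>)"
    using assms(2) by simp
  have 1: "sum weight (fset (finsert A \<Gamma>)) < sum weight (fset (finsert C \<Gamma>))"
    if "weight A < weight C" for A
    using that sum_weight_finsert_le[of A \<Gamma>] unfolding C by linarith
  have 2: "sum weight (fset (finsert A (finsert B \<Gamma>))) < sum weight (fset (finsert C \<Gamma>))"
    if "weight A + weight B < weight C" for A B
    using that sum_weight_finsert_le[of A "finsert B \<Gamma>"] sum_weight_finsert_le[of B \<Gamma>]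
    unfolding C by linarith
  consider (And) A B where "C = And A B" | (Or) A B where "C = Or A B"
    | (NegNeg) A where "C = Neg (Neg A)" | (NegAnd) A B where "C = Neg (And A B)"
    | (NegOr) A B where "C = Neg (Or A B)"
    using assms(1) unfolding literal_def by (metis form.exhaust)
  then show ?thesis
  proof cases
    case And
    show ?thesis
      using G_And[of A B \<Gamma> "{||}"] 2[of A B] unfolding And
      by (intro exI conjI) (assumption, auto)
  next
    case Or
    show ?thesis
      using G_Or[of A B \<Gamma> "{||}"] 1[of A] 1[of B] unfolding Or
      by (intro exI conjI) (assumption, auto)
  next
    case NegNeg
    show ?thesis
      using G_NegNeg[of A \<Gamma> "{||}"] 1[of A] unfolding NegNeg
      by (intro exI conjI) (assumption, auto)
  next
    case NegAnd
    show ?thesis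
      using G_NegAnd[of A B \<Gamma> "{||}"] 1[of "Neg A"] 1[of "Neg B"] unfolding NegAnd
      by (intro exI conjI) (assumption, auto)
  next
    case NegOr
    show ?thesis
      using G_NegOr[of A B \<Gamma> "{||}"] 2[of "Neg A" "Neg B"] unfolding NegOr
      by (intro exI conjI) (assumption, auto)
  qed
qed

text \<open>Induction on the total weight of the component. A branching rule yields two components,
  but each is lighter than the original, so the induction hypothesis applies to them
  separately.\<close>

lemma ex_literal_component_expansion:
  "\<exists>\<delta>. G_rule\<^sup>*\<^sup>* {|\<Gamma>|} \<delta> \<and> (\<forall>\<Delta>. \<Delta> |\<in>| \<delta> \<longrightarrow> (\<forall>A. A |\<in>| \<Delta> \<longrightarrow> literal A))"
proof (induction "sum weight (fset \<Gamma>)" arbitrary: \<Gamma> rule: less_induct)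
  case less
  show ?case
  proof (cases "\<forall>A. A |\<in>| \<Gamma> \<longrightarrow> literal A")
    case True
    then show ?thesis by (intro exI[of _ "{|\<Gamma>|}"]) simp
  next
    case False
    then obtain C where C: "C |\<in>| \<Gamma>" "\<not> literal C" by blast
    then obtain \<Gamma>' where \<Gamma>': "\<Gamma> = finsert C \<Gamma>'" "C |\<notin>| \<Gamma>'"
      by (meson mk_disjoint_finsert)
    obtain \<delta> where \<delta>: "G_rule {|\<Gamma>|} \<delta>"
        "\<forall>\<Delta>. \<Delta> |\<in>| \<delta> \<longrightarrow> sum weight (fset \<Delta>) < sum weight (fset \<Gamma>)"
      using ex_G_rule_decrease[OF C(2) \<Gamma>'(2)] unfolding \<Gamma>'(1) by blast
    have "\<exists>\<epsilon>. G_rule\<^sup>*\<^sup>* \<delta> \<epsilon> \<and> (\<forall>\<Delta>. \<Delta> |\<in>| \<epsilon> \<longrightarrow> (\<forall>A. A |\<in>| \<Delta> \<longrightarrow> literal A))"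
    proof (rule rtranclp_componentwise)
      fix \<Delta> assume "\<Delta> |\<in>| \<delta>"
      with \<delta>(2) show "\<exists>\<epsilon>. G_rule\<^sup>*\<^sup>* {|\<Delta>|} \<epsilon> \<and>
          (\<forall>\<Delta>. \<Delta> |\<in>| \<epsilon> \<longrightarrow> (\<forall>A. A |\<in>| \<Delta> \<longrightarrow> literal A))"
        by (intro less) blast
    qed (rule G_rule_funion)
    with \<delta>(1) show ?thesis by (meson converse_rtranclp_into_rtranclp)
  qed
qed

lemma ex_literal_expansion:
  "\<exists>\<delta>. G_rule\<^sup>*\<^sup>* \<alpha> \<delta> \<and> (\<forall>\<Delta>. \<Delta> |\<in>| \<delta> \<longrightarrow> (\<forall>A. A |\<in>| \<Delta> \<longrightarrow> literal A))"
  by (rule rtranclp_componentwise, erule G_rule_funion, rule ex_literal_component_expansion)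

section \<open>Restriction by NC and Del, splitting by EM\<close>

lemma Del_rule_fsubset: "\<Delta> |\<subseteq>| \<Gamma> \<Longrightarrow> Del_rule {|\<Gamma>|} {|\<Delta>|}"
  using Del[of \<Delta> \<Gamma> "{||}"] by (simp add: sup.absorb2)

lemma NC_rule_inconsistent: "\<not> consistent \<Gamma> \<Longrightarrow> NC_rule {|\<Gamma>|} {||}"
  unfolding consistent_def by (metis NC finsert_absorb)

text \<open>Consistency is recorded for the whole \<Gamma>, not just for its restriction: deleting
  literals may hide a clash, so NC has to be applied instead of Del.\<close>

lemma ex_consistent_restriction:
  "\<exists>\<gamma>. analytic_step\<^sup>*\<^sup>* \<alpha> \<gamma> \<and> (\<forall>\<Delta>. \<Delta> |\<in>| \<gamma> \<longrightarrow>
     (\<exists>\<Gamma>. \<Gamma> |\<in>| \<alpha> \<and> consistent \<Gamma> \<and> \<Delta> = ffilter (\<lambda>A. atoms A \<subseteq> S) \<Gamma>))"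
proof (rule rtranclp_componentwise)
  fix \<Gamma> assume \<Gamma>: "\<Gamma> |\<in>| \<alpha>"
  let ?\<Delta> = "ffilter (\<lambda>A. atoms A \<subseteq> S) \<Gamma>"
  have "analytic_step {|\<Gamma>|} {|?\<Delta>|}"
    unfolding analytic_step_def by (intro disjI2 Del_rule_fsubset) auto
  moreover have "analytic_step {|\<Gamma>|} {||}" if "\<not> consistent \<Gamma>"
    using NC_rule_inconsistent[OF that] unfolding analytic_step_def by blast
  \<comment> \<open>The witness is the restricted singleton if \<Gamma> is consistent and the empty
    datum otherwise.\<close>
  ultimately have "\<exists>\<gamma>. analytic_step {|\<Gamma>|} \<gamma> \<and> \<gamma> |\<subseteq>| {|?\<Delta>|} \<and> (\<gamma> \<noteq> {||} \<longrightarrow> consistent \<Gamma>)"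
    by blast
  then obtain \<gamma> where \<gamma>: "analytic_step {|\<Gamma>|} \<gamma>" "\<gamma> |\<subseteq>| {|?\<Delta>|}" "\<gamma> \<noteq> {||} \<longrightarrow> consistent \<Gamma>"
    by blast
  show "\<exists>\<gamma>. analytic_step\<^sup>*\<^sup>* {|\<Gamma>|} \<gamma> \<and> (\<forall>\<Delta>. \<Delta> |\<in>| \<gamma> \<longrightarrow>
     (\<exists>\<Gamma>. \<Gamma> |\<in>| \<alpha> \<and> consistent \<Gamma> \<and> \<Delta> = ffilter (\<lambda>A. atoms A \<subseteq> S) \<Gamma>))"
  proof (intro exI conjI allI impI)
    show "analytic_step\<^sup>*\<^sup>* {|\<Gamma>|} \<gamma>" using \<gamma>(1) by (rule r_into_rtranclp)
    fix \<Delta> assume "\<Delta> |\<in>| \<gamma>"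
    then show "consistent \<Gamma>" "\<Delta> = ?\<Delta>" using \<gamma>(2,3) by auto
  qed (rule \<Gamma>)
qed (rule analytic_step_funion)

text \<open>The semantic core of interpolation: the literals of \<Gamma> foreign to \<beta> can be
  made true by changing the valuation where \<beta> does not see it, and consistency prevents these
  choices from colliding.\<close>

lemma verifies_if_restriction_holds:
  assumes "consistent \<Gamma>" "\<And>A. A |\<in>| \<Gamma> \<Longrightarrow> literal A" "\<Gamma> |\<in>| \<alpha>"
    and "\<And>A. A |\<in>| \<Gamma> \<Longrightarrow> atoms A \<subseteq> atoms_datum \<beta> \<Longrightarrow> holds v A"
    and "entails \<alpha> \<beta>"
  shows "verifies v \<beta>"
proof -
  \<comment> \<open>Outside the atoms of \<beta> exactly the variables occurring as positive
    literals in \<Gamma> become true. A negative literal of \<Gamma> then holds because its variable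
    is not in \<Gamma>.\<close>
  define w where "w p \<longleftrightarrow> (if p \<in> atoms_datum \<beta> then v p else Var p |\<in>| \<Gamma>)" for p
  have "holds w A" if A: "A |\<in>| \<Gamma>" for A
    using assms(2)[OF A] assms(4)[OF A] assms(1) A
    by (auto simp: literal_def w_def consistent_def)
  then have "verifies w \<beta>"
    using assms(3,5) unfolding verifies_def entails_def by blast
  then show ?thesis
    using verifies_cong[of \<beta> v w] by (simp add: w_def)
qed

text \<open>\<open>S\<close> contains all atoms of \<beta> not yet decided by \<Gamma>, and the
  induction removes them one by one, with EM splitting on the undecided ones. Once every atom is
  decided, truth of a literal of \<beta> is membership in \<Gamma>, so Del ends in a component of
  \<beta>.\<close>

lemma quasi_synthetic_into_literal_datum:
  assumes "finite S" "consistent \<Gamma>" "\<And>A. A |\<in>| \<Gamma> \<Longrightarrow> literal A"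
    and "\<And>p. p \<in> atoms_datum \<beta> \<Longrightarrow> p \<in> S \<or> Var p |\<in>| \<Gamma> \<or> Neg (Var p) |\<in>| \<Gamma>"
    and "\<And>v. (\<forall>A. A |\<in>| \<Gamma> \<longrightarrow> holds v A) \<Longrightarrow> verifies v \<beta>"
    and lit: "\<And>\<Delta> A. \<Delta> |\<in>| \<beta> \<Longrightarrow> A |\<in>| \<Delta> \<Longrightarrow> literal A"
  shows "\<exists>\<delta>. quasi_synthetic_step\<^sup>*\<^sup>* {|\<Gamma>|} \<delta> \<and> (\<forall>\<Delta>. \<Delta> |\<in>| \<delta> \<longrightarrow> \<Delta> |\<in>| \<beta>)"
  using assms(1-5)
proof (induction S arbitrary: \<Gamma> rule: finite_induct)
  case empty
  \<comment> \<open>The canonical valuation of \<Gamma>; it verifies \<Gamma> by consistency and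
    hence some component \<Delta> of \<beta>.\<close>
  define v where "v p \<longleftrightarrow> Var p |\<in>| \<Gamma>" for p
  have "holds v A" if "A |\<in>| \<Gamma>" for A
    using empty.prems(1) empty.prems(2)[OF that] that
    by (auto simp: literal_def v_def consistent_def)
  then obtain \<Delta> where \<Delta>: "\<Delta> |\<in>| \<beta>" "\<And>A. A |\<in>| \<Delta> \<Longrightarrow> holds v A"
    using empty.prems(4) unfolding verifies_def by blast
  \<comment> \<open>One of the two literals on the atom of \<open>A\<close> lies in \<Gamma>; as
    \<open>A\<close> is true under \<open>v\<close>, it is the one that does.\<close>
  have "A |\<in>| \<Gamma>" if A: "A |\<in>| \<Delta>" for A
  proof -
    obtain p where p: "A = Var p \<or> A = Neg (Var p)"
      using lit[OF \<Delta>(1) A] unfolding literal_def by blast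
    then have "p \<in> atoms_datum \<beta>"
      using \<Delta>(1) that by (force simp: atoms_datum_def)
    from empty.prems(3)[OF this] p \<Delta>(2)[OF that] show ?thesis
      by (auto simp: v_def)
  qed
  then have "quasi_synthetic_step {|\<Gamma>|} {|\<Delta>|}"
    unfolding quasi_synthetic_step_def S_step_def by (blast intro: Del_rule_fsubset)
  with \<Delta>(1) show ?case by (intro exI[of _ "{|\<Delta>|}"]) auto
next
  case (insert p S)
  show ?case
  \<comment> \<open>Splitting on an atom that is already decided would create an inconsistent
    component, so EM is applied only when \<open>p\<close> is undecided.\<close>
  proof (cases "Var p |\<in>| \<Gamma> \<or> Neg (Var p) |\<in>| \<Gamma>")
    case True
    show ?thesis
      by (rule insert.IH) (use insert.prems True in blast)+
  next
    case False
    \<comment> \<open>Either literal on \<open>p\<close> decides \<open>p\<close>, which may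
      therefore leave the set of pending atoms. The semantic hypothesis survives because the
      component only grows.\<close>
    have ext: "\<exists>\<delta>. quasi_synthetic_step\<^sup>*\<^sup>* {|finsert L \<Gamma>|} \<delta> \<and> (\<forall>\<Delta>. \<Delta> |\<in>| \<delta> \<longrightarrow> \<Delta> |\<in>| \<beta>)"
      if L: "L = Var p \<or> L = Neg (Var p)" for L
    proof (rule insert.IH)
      show "consistent (finsert L \<Gamma>)"
        using insert.prems(1) False L unfolding consistent_def by auto
    qed (use insert.prems(2-4) L in \<open>auto simp: literal_def\<close>)
    have "\<exists>\<delta>. quasi_synthetic_step\<^sup>*\<^sup>* {|finsert (Var p) \<Gamma>, finsert (Neg (Var p)) \<Gamma>|} \<delta>
        \<and> (\<forall>\<Delta>. \<Delta> |\<in>| \<delta> \<longrightarrow> \<Delta> |\<in>| \<beta>)"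
      by (rule rtranclp_componentwise, erule quasi_synthetic_step_funion) (use ext in auto)
    moreover have "quasi_synthetic_step {|\<Gamma>|} {|finsert (Var p) \<Gamma>, finsert (Neg (Var p)) \<Gamma>|}"
      unfolding quasi_synthetic_step_def synthetic_step_def
      using EM[of \<Gamma> "{||}" "Var p"] by blast
    ultimately show ?thesis by (meson converse_rtranclp_into_rtranclp)
  qed
qed

section \<open>Assembling the two deductions\<close>

lemma quasi_synthetic_fsubset: "\<alpha> |\<subseteq>| \<beta> \<Longrightarrow> quasi_synthetic_step\<^sup>*\<^sup>* \<alpha> \<beta>"
proof -
  have "quasi_synthetic_step\<^sup>*\<^sup>* \<alpha> (\<beta> |\<union>| \<alpha>)"
  proof (induction \<beta>)
    case (insert \<Gamma> \<beta>)
    have "quasi_synthetic_step (\<beta> |\<union>| \<alpha>) (finsert \<Gamma> \<beta> |\<union>| \<alpha>)"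
      unfolding quasi_synthetic_step_def S_step_def by (simp add: Exp)
    with insert.IH show ?case by (rule rtranclp.rtrancl_into_rtrancl)
  qed simp
  then show "\<alpha> |\<subseteq>| \<beta> \<Longrightarrow> quasi_synthetic_step\<^sup>*\<^sup>* \<alpha> \<beta>" by (simp add: sup.absorb1)
qed

lemma G_rules_analytic: "G_rule\<^sup>*\<^sup>* \<alpha> \<beta> \<Longrightarrow> analytic_step\<^sup>*\<^sup>* \<alpha> \<beta>"
  by (erule mono_rtranclp[rule_format, rotated]) (simp add: analytic_step_def)

lemma G_rules_converse_quasi_synthetic: "G_rule\<^sup>*\<^sup>* \<alpha> \<beta> \<Longrightarrow> quasi_synthetic_step\<^sup>*\<^sup>* \<beta> \<alpha>"
  by (induction rule: rtranclp_induct)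
    (auto intro: converse_rtranclp_into_rtranclp
      simp: quasi_synthetic_step_def synthetic_step_def)

lemma finite_atoms_datum: "finite (atoms_datum \<alpha>)"
proof -
  have "finite (atoms A)" for A :: "'b form" by (induction A) auto
  then show ?thesis by (simp add: atoms_datum_def)
qed

theorem mainTheorem2:
  fixes \<alpha> \<beta> :: "'a datum"
  assumes "entails \<alpha> \<beta>"
  shows "\<exists>\<gamma> :: 'a datum.
           atoms_datum \<gamma> \<subseteq> atoms_datum \<alpha> \<inter> atoms_datum \<beta> \<and>
           analytically_deducible \<alpha> \<gamma> \<and>
           quasi_synthetically_deducible \<gamma> \<beta>"
proof -
  obtain \<alpha>' where \<alpha>': "G_rule\<^sup>*\<^sup>* \<alpha> \<alpha>'" "\<And>\<Gamma> A. \<Gamma> |\<in>| \<alpha>' \<Longrightarrow> A |\<in>| \<Gamma> \<Longrightarrow> literal A"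
    using ex_literal_expansion[of \<alpha>] by blast
  obtain \<beta>' where \<beta>': "G_rule\<^sup>*\<^sup>* \<beta> \<beta>'" "\<And>\<Gamma> A. \<Gamma> |\<in>| \<beta>' \<Longrightarrow> A |\<in>| \<Gamma> \<Longrightarrow> literal A"
    using ex_literal_expansion[of \<beta>] by blast
  have ent: "entails \<alpha>' \<beta>'"
    using assms G_rules_verifies[OF \<alpha>'(1)] G_rules_verifies[OF \<beta>'(1)]
    by (simp add: entails_def)
  \<comment> \<open>The interpolant: deleting what is foreign to \<open>\<beta>'\<close> bounds its
    atoms on one side, and taking literals only from \<open>\<alpha>'\<close> bounds them on the
    other. The G-rules keep atoms, so the bounds carry over to \<alpha> and \<beta>.\<close>
  obtain \<gamma> where \<gamma>: "analytic_step\<^sup>*\<^sup>* \<alpha>' \<gamma>" "\<And>\<Delta>. \<Delta> |\<in>| \<gamma> \<Longrightarrow>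
      \<exists>\<Gamma>. \<Gamma> |\<in>| \<alpha>' \<and> consistent \<Gamma> \<and> \<Delta> = ffilter (\<lambda>A. atoms A \<subseteq> atoms_datum \<beta>') \<Gamma>"
    using ex_consistent_restriction[of \<alpha>' "atoms_datum \<beta>'"] by blast
  have "atoms_datum \<gamma> \<subseteq> atoms_datum \<alpha>' \<inter> atoms_datum \<beta>'"
    using \<gamma>(2) by (fastforce simp: atoms_datum_def[of \<gamma>] atoms_datum_def[of \<alpha>'])
  then have "atoms_datum \<gamma> \<subseteq> atoms_datum \<alpha> \<inter> atoms_datum \<beta>"
    using G_rules_atoms_datum[OF \<alpha>'(1)] G_rules_atoms_datum[OF \<beta>'(1)] by simp
  moreover have "analytically_deducible \<alpha> \<gamma>"
    unfolding analytically_deducible_def ex_deduction_iff_rtranclp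
    using G_rules_analytic[OF \<alpha>'(1)] \<gamma>(1) by (rule rtranclp_trans)
  moreover have "quasi_synthetically_deducible \<gamma> \<beta>"
  proof -
    have "\<exists>\<delta>. quasi_synthetic_step\<^sup>*\<^sup>* \<gamma> \<delta> \<and> (\<forall>\<Delta>. \<Delta> |\<in>| \<delta> \<longrightarrow> \<Delta> |\<in>| \<beta>')"
    proof (rule rtranclp_componentwise)
      fix \<Delta> assume "\<Delta> |\<in>| \<gamma>"
      then obtain \<Gamma> where \<Gamma>: "\<Gamma> |\<in>| \<alpha>'" "consistent \<Gamma>"
        and \<Delta>: "\<Delta> = ffilter (\<lambda>A. atoms A \<subseteq> atoms_datum \<beta>') \<Gamma>"
        using \<gamma>(2) by blast
      show "\<exists>\<delta>. quasi_synthetic_step\<^sup>*\<^sup>* {|\<Delta>|} \<delta> \<and> (\<forall>\<Delta>. \<Delta> |\<in>| \<delta> \<longrightarrow> \<Delta> |\<in>| \<beta>')"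
      \<comment> \<open>All atoms of \<open>\<beta>'\<close> start as pending, so the condition that
        each is pending or decided holds at once.\<close>
      proof (rule quasi_synthetic_into_literal_datum[OF finite_atoms_datum[of \<beta>']])
        show "consistent \<Delta>" using \<Gamma>(2) by (simp add: \<Delta> consistent_def)
        show "literal A" if "A |\<in>| \<Delta>" for A
          using that \<alpha>'(2)[OF \<Gamma>(1)] by (simp add: \<Delta>)
        show "verifies v \<beta>'" if "\<forall>A. A |\<in>| \<Delta> \<longrightarrow> holds v A" for v
          by (rule verifies_if_restriction_holds[OF \<Gamma>(2) \<alpha>'(2)[OF \<Gamma>(1)] \<Gamma>(1) _ ent])
            (use that in \<open>auto simp: \<Delta>\<close>)
      qed (use \<beta>'(2) in auto)
    qed (rule quasi_synthetic_step_funion)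
    then obtain \<delta> where "quasi_synthetic_step\<^sup>*\<^sup>* \<gamma> \<delta>" "\<delta> |\<subseteq>| \<beta>'" by blast
    \<comment> \<open>The chain runs from \<gamma> through \<delta> to \<open>\<beta>'\<close> by
      Exp, and on to \<beta> by the G-rules read backwards.\<close>
    then have "quasi_synthetic_step\<^sup>*\<^sup>* \<gamma> \<beta>"
      using quasi_synthetic_fsubset G_rules_converse_quasi_synthetic[OF \<beta>'(1)]
      by (meson rtranclp_trans)
    then show ?thesis
      unfolding quasi_synthetically_deducible_def ex_deduction_iff_rtranclp .
  qed
  ultimately show ?thesis by blast
qed

end
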